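(* Let $q$ be a prime power, let $n\ge 1$, and let $s=|\mathbb{F}_q^{+}|$ be the number of positive elements of $\mathbb{F}_q$. Let $\mathrm{pd}_4(n)$ be the number of positive definite matrices of type 4 in $\mathrm{GL}_n(\mathbb{F}_q)$. Then $$\mathrm{pd}_4(n)=\sum_{\substack{k_1+k_2+\dots+k_s=n\\ k_i\ge 0}}\frac{|\mathrm{O}_n(\mathbb{F}_q)|}{|\mathrm{O}_{k_1}(\mathbb{F}_q)|\,|\mathrm{O}_{k_2}(\mathbb{F}_q)|\cdots|\mathrm{O}_{k_s}(\mathbb{F}_q)|},$$ where the sum is over all $s$-tuples $(k_1,\dots,k_s)$ of nonnegative integers with sum $n$.
   Context: An element $a\in\mathbb{F}_q^\times$ is positive if $a=b^2$ for some $b\in\mathbb{F}_q^\times$; $\mathbb{F}_q^{+}$ is the set of positive elements. $\mathrm{O}_k(\mathbb{F}_q)=\{U\in\mathrm{GL}_k(\mathbb{F}_q): U^TU=I_k\}$, with the convention $|\mathrm{O}_0(\mathbb{F}_q)|=1$. A symmetric matrix $A\in\mathrm{GL}_n(\mathbb{F}_q)$ is positive definite of type 4 if there exist $U\in\mathrm{O}_n(\mathbb{F}_q)$ and a diagonal matrix $D\in\mathrm{GL}_n(\mathbb{F}_q)$ with all diagonal entries positive such that $A=U^{-1}DU$. *)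

theory Defs
  imports "Jordan_Normal_Form.Matrix" "HOL-Number_Theory.Prime_Powers"
begin

definition positive_elements :: "'a::field set" where
  "positive_elements = {a. a \<noteq> 0 \<and> (\<exists>b. b \<noteq> 0 \<and> a = b ^ 2)}"

definition general_linear :: "nat \<Rightarrow> 'a::field mat set" where
  "general_linear n = {A. A \<in> carrier_mat n n \<and> invertible_mat A}"

(* For k = 0 the only element is the empty matrix, which realizes the convention |O_0| = 1. *)
definition orthogonal_matrices :: "nat \<Rightarrow> 'a::field mat set" where
  "orthogonal_matrices k = {U. U \<in> general_linear k \<and> transpose_mat U * U = 1\<^sub>m k}"

(* V plays the role of the inverse of U. *)
definition positive_definite_type4 :: "nat \<Rightarrow> 'a::field mat \<Rightarrow> bool" where
  "positive_definite_type4 n A \<longleftrightarrow>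
     A \<in> general_linear n \<and> transpose_mat A = A \<and>
     (\<exists>U V D. U \<in> orthogonal_matrices n \<and>
        V \<in> carrier_mat n n \<and> inverts_mat U V \<and> inverts_mat V U \<and>
        D \<in> general_linear n \<and> diagonal_mat D \<and>
        (\<forall>i<n. D $$ (i, i) \<in> positive_elements) \<and>
        A = V * D * U)"

lemma orthogonal_matrices_0: "card (orthogonal_matrices 0 :: 'a::field mat set) = 1"
proof -
  have "(orthogonal_matrices 0 :: 'a mat set) = {1\<^sub>m 0}"
    by (auto simp: orthogonal_matrices_def general_linear_def invertible_mat_def inverts_mat_def
        square_mat.simps intro!: exI[of _ "1\<^sub>m 0"])
  then show ?thesis
    by simp
qed

end

theory Submission
  imports Defs "Jordan_Normal_Form.Char_Poly" "HOL-Combinatorics.Permutations"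
begin

text \<open>The orthogonal group acts by conjugation on the matrices in question. Every orbit contains a
  diagonal matrix, which is determined up to permutation of its entries by the characteristic
  polynomial of the orbit; permutation matrices are orthogonal, so the orbits correspond to the tuples
  of multiplicities of the positive elements. The orthogonal matrices commuting with a diagonal matrix
  preserve its eigenspaces, so they form the product of the orthogonal groups whose sizes are these
  multiplicities, and each orbit is counted by the orbit-stabiliser theorem.\<close>

section \<open>The orthogonal group: closure properties, entries, finiteness\<close>

text \<open>Over a field a left inverse of a square matrix is also a right inverse, so
  \<open>transpose_mat U\<close> is a two-sided inverse and itself witnesses invertibility.\<close>

lemma orthogonal_matrices_iff:
  fixes U :: "'a::field mat"
  shows "U \<in> orthogonal_matrices n \<longleftrightarrow>
    U \<in> carrier_mat n n \<and> transpose_mat U * U = 1\<^sub>m n \<and> U * transpose_mat U = 1\<^sub>m n"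
proof
  assume "U \<in> orthogonal_matrices n"
  then have U: "U \<in> carrier_mat n n" and "transpose_mat U * U = 1\<^sub>m n"
    by (auto simp: orthogonal_matrices_def general_linear_def)
  then show "U \<in> carrier_mat n n \<and> transpose_mat U * U = 1\<^sub>m n \<and> U * transpose_mat U = 1\<^sub>m n"
    using mat_mult_left_right_inverse[of "transpose_mat U" n U] by auto
next
  assume "U \<in> carrier_mat n n \<and> transpose_mat U * U = 1\<^sub>m n \<and> U * transpose_mat U = 1\<^sub>m n"
  then show "U \<in> orthogonal_matrices n"
    by (auto simp: orthogonal_matrices_def general_linear_def invertible_mat_def inverts_mat_def
        square_mat.simps intro!: exI[of _ "transpose_mat U"])
qed

lemma orthogonal_matricesI:
  fixes U :: "'a::field mat"
  assumes "U \<in> carrier_mat n n" "transpose_mat U * U = 1\<^sub>m n"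
  shows "U \<in> orthogonal_matrices n"
  using assms mat_mult_left_right_inverse[of "transpose_mat U" n U]
  by (auto simp: orthogonal_matrices_iff)

lemma orthogonal_matricesD:
  fixes U :: "'a::field mat"
  assumes "U \<in> orthogonal_matrices n"
  shows "U \<in> carrier_mat n n" "transpose_mat U \<in> carrier_mat n n"
    "transpose_mat U * U = 1\<^sub>m n" "U * transpose_mat U = 1\<^sub>m n"
  using assms by (auto simp: orthogonal_matrices_iff)

lemma one_orthogonal_matrices: "(1\<^sub>m n :: 'a::field mat) \<in> orthogonal_matrices n"
  by (auto simp: orthogonal_matrices_iff)

lemma transpose_orthogonal_matrices:
  "U \<in> orthogonal_matrices n \<Longrightarrow> transpose_mat U \<in> orthogonal_matrices n"
  by (auto simp: orthogonal_matrices_iff)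

lemma mult_orthogonal_matrices:
  fixes U W :: "'a::field mat"
  assumes "U \<in> orthogonal_matrices n" "W \<in> orthogonal_matrices n"
  shows "U * W \<in> orthogonal_matrices n"
proof (rule orthogonal_matricesI)
  note U = orthogonal_matricesD[OF assms(1)] and W = orthogonal_matricesD[OF assms(2)]
  show "U * W \<in> carrier_mat n n"
    using U W by simp
  have "transpose_mat (U * W) * (U * W) = (transpose_mat W * transpose_mat U) * (U * W)"
    using U W by (simp add: transpose_mult)
  also have "\<dots> = transpose_mat W * ((transpose_mat U * U) * W)"
    using U(1,2) W(1,2) by (simp add: assoc_mult_mat[of _ n n _ n _ n])
  also have "\<dots> = 1\<^sub>m n"
    using U W by simp
  finally show "transpose_mat (U * W) * (U * W) = 1\<^sub>m n" .
qed

text \<open>The columns are orthonormal. This entrywise form is what survives relabelling of indices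
  and restriction to blocks.\<close>

lemma orthogonal_matrices_index:
  fixes U :: "'a::field mat"
  assumes "U \<in> carrier_mat n n"
  shows "U \<in> orthogonal_matrices n \<longleftrightarrow>
    (\<forall>i<n. \<forall>j<n. (\<Sum>k<n. U $$ (k, i) * U $$ (k, j)) = (if i = j then 1 else 0))"
proof -
  have ent: "(transpose_mat U * U) $$ (i, j) = (\<Sum>k<n. U $$ (k, i) * U $$ (k, j))"
    if "i < n" "j < n" for i j
    using assms that by (simp add: scalar_prod_def atLeast0LessThan)
  have "U \<in> orthogonal_matrices n \<longleftrightarrow> transpose_mat U * U = 1\<^sub>m n"
    using assms orthogonal_matricesI orthogonal_matricesD(3) by blast
  also have "\<dots> \<longleftrightarrow> (\<forall>i<n. \<forall>j<n. (transpose_mat U * U) $$ (i, j) = (if i = j then 1 else 0))"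
    using assms by (auto simp: mat_eq_iff)
  finally show ?thesis
    using ent by simp
qed

lemma finite_orthogonal_matrices: "finite (orthogonal_matrices n :: 'a::{field,finite} mat set)"
proof (rule inj_on_finite)
  \<comment> \<open>A matrix is determined by its entries; restricting the entry function to the
    index square places it in a finite space of extensional functions.\<close>
  let ?f = "\<lambda>U :: 'a mat. restrict (\<lambda>ij. U $$ ij) ({..<n} \<times> {..<n})"
  show "inj_on ?f (orthogonal_matrices n)"
  proof (rule inj_onI)
    fix U W :: "'a mat"
    assume U: "U \<in> orthogonal_matrices n" and W: "W \<in> orthogonal_matrices n" and eq: "?f U = ?f W"
    show "U = W"
    proof (rule eq_matI)
      fix i j assume "i < dim_row W" "j < dim_col W"
      then show "U $$ (i, j) = W $$ (i, j)"
        using fun_cong[OF eq, of "(i, j)"] orthogonal_matricesD(1)[OF W] by auto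
    qed (use orthogonal_matricesD(1)[OF U] orthogonal_matricesD(1)[OF W] in auto)
  qed
  show "?f ` orthogonal_matrices n \<subseteq> {..<n} \<times> {..<n} \<rightarrow>\<^sub>E UNIV"
    by (intro image_subsetI restrict_PiE_iff[THEN iffD2] ballI) simp
  show "finite ({..<n} \<times> {..<n} \<rightarrow>\<^sub>E (UNIV :: 'a set))"
    by (simp add: finite_PiE)
qed

lemma card_orthogonal_matrices_pos: "card (orthogonal_matrices n :: 'a::{field,finite} mat set) > 0"
  using finite_orthogonal_matrices[where 'a = 'a] one_orthogonal_matrices[where 'a = 'a]
  by (auto simp: card_gt_0_iff)

section \<open>Orthogonal matrices over arbitrary index sets\<close>

text \<open>The level sets of a diagonal are rarely initial segments of the naturals, so the blocks
  of a stabiliser need rows and columns labelled by any set. Extensionality gives each such matrix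
  exactly one function, which makes counting meaningful.\<close>

definition orthogonal_on :: "'b set \<Rightarrow> ('b \<times> 'b \<Rightarrow> 'a::field) set" where
  "orthogonal_on I = {f \<in> extensional (I \<times> I).
     \<forall>i\<in>I. \<forall>j\<in>I. (\<Sum>k\<in>I. f (k, i) * f (k, j)) = (if i = j then 1 else 0)}"

text \<open>Relabelling rows and columns by the same bijection only reindexes the sums that express
  orthonormality.\<close>

lemma card_orthogonal_on:
  assumes "finite I"
  shows "card (orthogonal_on I :: ('b \<times> 'b \<Rightarrow> 'a::field) set) =
    card (orthogonal_matrices (card I) :: 'a mat set)"
proof -
  obtain h where h: "bij_betw h {..<card I} I"
    using ex_bij_betw_nat_finite[OF assms] by (auto simp: atLeast0LessThan)
  define g where "g = the_inv_into {..<card I} h"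
  have g: "bij_betw g I {..<card I}"
    unfolding g_def by (rule bij_betw_the_inv_into[OF h])
  have gh: "g (h i) = i" if "i < card I" for i
    unfolding g_def using h that by (simp add: bij_betw_def the_inv_into_f_f)
  have hg: "h (g i) = i" if "i \<in> I" for i
    unfolding g_def using h that by (simp add: bij_betw_def f_the_inv_into_f)
  have gI: "g i < card I" if "i \<in> I" for i
    using g that by (auto simp: bij_betw_def)
  have hI: "h i \<in> I" if "i < card I" for i
    using h that by (auto simp: bij_betw_def)
  have "bij_betw (\<lambda>U :: 'a mat. restrict (\<lambda>(i, j). U $$ (g i, g j)) (I \<times> I))
    (orthogonal_matrices (card I)) (orthogonal_on I)"
  proof (rule bij_betw_byWitness[where f' = "\<lambda>f. mat (card I) (card I) (\<lambda>(i, j). f (h i, h j))"])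
    show "\<forall>U\<in>orthogonal_matrices (card I). mat (card I) (card I)
      (\<lambda>(i, j). restrict (\<lambda>(i, j). U $$ (g i, g j)) (I \<times> I) (h i, h j)) = (U :: 'a mat)"
      by (auto intro!: eq_matI simp: gh hI dest!: orthogonal_matricesD(1))
    show "\<forall>f\<in>orthogonal_on I. restrict (\<lambda>(i, j). mat (card I) (card I)
      (\<lambda>(i, j). f (h i, h j)) $$ (g i, g j)) (I \<times> I) = (f :: 'b \<times> 'b \<Rightarrow> 'a)"
      by (auto simp: orthogonal_on_def fun_eq_iff restrict_def extensional_def gI hg)
    show "(\<lambda>U :: 'a mat. restrict (\<lambda>(i, j). U $$ (g i, g j)) (I \<times> I)) `
      orthogonal_matrices (card I) \<subseteq> orthogonal_on I"
    proof (rule image_subsetI)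
      fix U :: "'a mat" assume U: "U \<in> orthogonal_matrices (card I)"
      have "(\<Sum>k\<in>I. U $$ (g k, g i) * U $$ (g k, g j)) = (if i = j then 1 else 0)"
        if "i \<in> I" "j \<in> I" for i j
      proof -
        have "(\<Sum>k\<in>I. U $$ (g k, g i) * U $$ (g k, g j)) =
            (\<Sum>k<card I. U $$ (k, g i) * U $$ (k, g j))"
          by (rule sum.reindex_bij_betw[OF g])
        also have "\<dots> = (if g i = g j then 1 else 0)"
          using U that gI orthogonal_matrices_index[OF orthogonal_matricesD(1)[OF U]] by simp
        finally show ?thesis
          using hg that by metis
      qed
      then show "restrict (\<lambda>(i, j). U $$ (g i, g j)) (I \<times> I) \<in> orthogonal_on I"
        by (simp add: orthogonal_on_def)
    qed
    show "(\<lambda>f. mat (card I) (card I) (\<lambda>(i, j). f (h i, h j))) ` orthogonal_on I \<subseteq>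
      (orthogonal_matrices (card I) :: 'a mat set)"
    proof (rule image_subsetI)
      fix f :: "'b \<times> 'b \<Rightarrow> 'a" assume f: "f \<in> orthogonal_on I"
      have "(\<Sum>k<card I. f (h k, h i) * f (h k, h j)) = (if i = j then 1 else 0)"
        if "i < card I" "j < card I" for i j
      proof -
        have "(\<Sum>k<card I. f (h k, h i) * f (h k, h j)) = (\<Sum>k\<in>I. f (k, h i) * f (k, h j))"
          by (rule sum.reindex_bij_betw[OF h])
        also have "\<dots> = (if h i = h j then 1 else 0)"
          using f that hI by (simp add: orthogonal_on_def)
        finally show ?thesis
          using gh that by metis
      qed
      then show "mat (card I) (card I) (\<lambda>(i, j). f (h i, h j)) \<in> orthogonal_matrices (card I)"
        by (subst orthogonal_matrices_index) auto
    qed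
  qed
  then show ?thesis
    by (rule bij_betw_same_card[symmetric])
qed

section \<open>Orbits and stabilisers under orthogonal conjugation\<close>

text \<open>For orthogonal \<open>U\<close> the transpose is the inverse, so this is the orbit under
  conjugation.\<close>

definition orthogonal_orbit :: "nat \<Rightarrow> 'a::field mat \<Rightarrow> 'a mat set" where
  "orthogonal_orbit n D = (\<lambda>U. transpose_mat U * D * U) ` orthogonal_matrices n"

text \<open>Commuting with \<open>D\<close> is the same as fixing it under conjugation
  (\<open>orthogonal_commutes_iff\<close>), and for diagonal \<open>D\<close> it can be read off
  entry by entry.\<close>

definition orthogonal_stabilizer :: "nat \<Rightarrow> 'a::field mat \<Rightarrow> 'a mat set" where
  "orthogonal_stabilizer n D = {W \<in> orthogonal_matrices n. D * W = W * D}"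

text \<open>Conjugation is a right action. Composition of orbits and the coset description of the
  fibres both rest on this.\<close>

lemma orthogonal_conjugate_mult:
  fixes D U W :: "'a::field mat"
  assumes "U \<in> carrier_mat n n" "W \<in> carrier_mat n n" "D \<in> carrier_mat n n"
  shows "transpose_mat (W * U) * D * (W * U) = transpose_mat U * (transpose_mat W * D * W) * U"
proof -
  have "transpose_mat (W * U) = transpose_mat U * transpose_mat W"
    using assms by (simp add: transpose_mult)
  then show ?thesis
    using assms by (simp add: assoc_mult_mat[of _ n n _ n _ n])
qed

lemma orthogonal_commutes_iff:
  fixes D W :: "'a::field mat"
  assumes "W \<in> orthogonal_matrices n" "D \<in> carrier_mat n n"
  shows "D * W = W * D \<longleftrightarrow> transpose_mat W * D * W = D"
proof
  note W = orthogonal_matricesD[OF assms(1)]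
  { assume "D * W = W * D"
    then have "transpose_mat W * D * W = (transpose_mat W * W) * D"
      using W(1,2) assms(2) by (simp add: assoc_mult_mat[of _ n n _ n _ n])
    then show "transpose_mat W * D * W = D"
      using W assms(2) by simp }
  assume "transpose_mat W * D * W = D"
  then have "W * D = W * (transpose_mat W * D * W)"
    by simp
  also have "\<dots> = (W * transpose_mat W) * (D * W)"
    using W(1,2) assms(2) by (simp add: assoc_mult_mat[of _ n n _ n _ n])
  finally show "D * W = W * D"
    using W assms(2) by simp
qed

text \<open>The fibre through \<open>U\<close> is the coset of the stabiliser obtained by
  multiplying with \<open>U\<close> on the right; multiplying by \<open>transpose_mat U\<close> goes
  back.\<close>

lemma card_orthogonal_fibre:
  fixes D U :: "'a::field mat"
  assumes U: "U \<in> orthogonal_matrices n" and D: "D \<in> carrier_mat n n"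
  shows "card {X \<in> orthogonal_matrices n. transpose_mat X * D * X = transpose_mat U * D * U} =
    card (orthogonal_stabilizer n D)"
proof -
  note Uc = orthogonal_matricesD[OF U]
  have UU: "Y * transpose_mat U * U = Y" "Y * U * transpose_mat U = Y" if "Y \<in> carrier_mat n n" for Y
    using Uc that by (simp_all add: assoc_mult_mat[of _ n n _ n _ n])
  have "bij_betw (\<lambda>W. W * U) (orthogonal_stabilizer n D)
    {X \<in> orthogonal_matrices n. transpose_mat X * D * X = transpose_mat U * D * U}"
  proof (rule bij_betw_byWitness[where f' = "\<lambda>X. X * transpose_mat U"])
    show "\<forall>W\<in>orthogonal_stabilizer n D. W * U * transpose_mat U = W"
      by (auto simp: orthogonal_stabilizer_def UU orthogonal_matricesD(1))
    show "\<forall>X\<in>{X \<in> orthogonal_matrices n. transpose_mat X * D * X = transpose_mat U * D * U}.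
        X * transpose_mat U * U = X"
      by (auto simp: UU orthogonal_matricesD(1))
    show "(\<lambda>W. W * U) ` orthogonal_stabilizer n D \<subseteq>
      {X \<in> orthogonal_matrices n. transpose_mat X * D * X = transpose_mat U * D * U}"
    proof (rule image_subsetI)
      fix W assume "W \<in> orthogonal_stabilizer n D"
      then have W: "W \<in> orthogonal_matrices n" and c: "D * W = W * D"
        by (auto simp: orthogonal_stabilizer_def)
      have "transpose_mat (W * U) * D * (W * U) = transpose_mat U * D * U"
        using orthogonal_conjugate_mult[OF Uc(1) orthogonal_matricesD(1)[OF W] D]
          orthogonal_commutes_iff[OF W D] c by simp
      then show "W * U \<in> {X \<in> orthogonal_matrices n. transpose_mat X * D * X = transpose_mat U * D * U}"
        using mult_orthogonal_matrices[OF W U] by simp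
    qed
    show "(\<lambda>X. X * transpose_mat U) ` {X \<in> orthogonal_matrices n.
      transpose_mat X * D * X = transpose_mat U * D * U} \<subseteq> orthogonal_stabilizer n D"
    proof (rule image_subsetI)
      fix X assume "X \<in> {X \<in> orthogonal_matrices n. transpose_mat X * D * X = transpose_mat U * D * U}"
      then have X: "X \<in> orthogonal_matrices n"
        and eq: "transpose_mat X * D * X = transpose_mat U * D * U"
        by auto
      have XU: "X * transpose_mat U \<in> orthogonal_matrices n"
        by (intro mult_orthogonal_matrices transpose_orthogonal_matrices X U)
      have "transpose_mat (X * transpose_mat U) * D * (X * transpose_mat U) =
          U * (transpose_mat U * D * U) * transpose_mat U"
        using orthogonal_conjugate_mult[OF Uc(2) orthogonal_matricesD(1)[OF X] D] eq by simp
      also have "\<dots> = (U * transpose_mat U) * D * (U * transpose_mat U)"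
        using Uc(1,2) D by (simp add: assoc_mult_mat[of _ n n _ n _ n])
      also have "\<dots> = D"
        using Uc D by simp
      finally show "X * transpose_mat U \<in> orthogonal_stabilizer n D"
        using XU orthogonal_commutes_iff[OF XU D] by (simp add: orthogonal_stabilizer_def)
    qed
  qed
  then show ?thesis
    by (rule bij_betw_same_card[symmetric])
qed

text \<open>The fibres of the map from the group onto the orbit partition the group, and all of them
  have the size of the stabiliser.\<close>

lemma card_orthogonal_orbit_stabilizer:
  fixes D :: "'a::{field,finite} mat"
  assumes D: "D \<in> carrier_mat n n"
  shows "card (orthogonal_orbit n D) * card (orthogonal_stabilizer n D) =
    card (orthogonal_matrices n :: 'a mat set)"
proof -
  let ?f = "\<lambda>U :: 'a mat. transpose_mat U * D * U"
  have "card (orthogonal_matrices n :: 'a mat set) =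
      (\<Sum>A\<in>orthogonal_orbit n D. card {X \<in> orthogonal_matrices n. ?f X = A})"
    using sum.image_gen[OF finite_orthogonal_matrices, of "\<lambda>_. 1 :: nat" n ?f]
    by (simp add: orthogonal_orbit_def)
  also have "\<dots> = (\<Sum>A\<in>orthogonal_orbit n D. card (orthogonal_stabilizer n D))"
    by (rule sum.cong) (auto simp: orthogonal_orbit_def card_orthogonal_fibre[OF _ D])
  finally show ?thesis
    by simp
qed

section \<open>Stabilisers of diagonal matrices\<close>

text \<open>The two products have the entries \<open>d i * W $$ (i, j)\<close> and
  \<open>W $$ (i, j) * d j\<close>.\<close>

lemma mat_diag_commutes_iff:
  fixes W :: "'a::field mat"
  assumes "W \<in> carrier_mat n n"
  shows "mat_diag n d * W = W * mat_diag n d \<longleftrightarrow>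
    (\<forall>i<n. \<forall>j<n. d i \<noteq> d j \<longrightarrow> W $$ (i, j) = 0)"
  using assms by (auto simp: mat_diag_mult_left mat_diag_mult_right mat_eq_iff)

text \<open>A matrix commuting with a diagonal matrix is block diagonal with respect to the level sets of
  the diagonal.\<close>

lemma card_orthogonal_stabilizer_mat_diag:
  fixes d :: "nat \<Rightarrow> 'a::field"
  assumes P: "finite P" and dP: "\<And>i. i < n \<Longrightarrow> d i \<in> P"
  shows "card (orthogonal_stabilizer n (mat_diag n d)) =
    (\<Prod>a\<in>P. card (orthogonal_matrices (card {i. i < n \<and> d i = a}) :: 'a mat set))"
proof -
  define I where "I a = {i. i < n \<and> d i = a}" for a
  define S :: "'a mat set" where "S = {W \<in> orthogonal_matrices n. \<forall>i<n. \<forall>j<n. d i \<noteq> d j \<longrightarrow> W $$ (i, j) = 0}"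
  have S: "orthogonal_stabilizer n (mat_diag n d) = S"
    unfolding orthogonal_stabilizer_def S_def
    using mat_diag_commutes_iff orthogonal_matricesD(1) by blast
  \<comment> \<open>A summand can be nonzero only if \<open>d k\<close> equals both
    \<open>d i\<close> and \<open>d j\<close>; hence columns from different blocks are orthogonal,
    and within a block only its own rows count.\<close>
  have gram: "(\<Sum>k<n. W $$ (k, i) * W $$ (k, j)) =
      (if d i = d j then \<Sum>k\<in>I (d i). W $$ (k, i) * W $$ (k, j) else 0)"
    if W: "\<forall>i<n. \<forall>j<n. d i \<noteq> d j \<longrightarrow> W $$ (i, j) = 0" and ij: "i < n" "j < n"
    for W :: "'a mat" and i j
  proof (cases "d i = d j")
    case True
    have "(\<Sum>k<n. W $$ (k, i) * W $$ (k, j)) = (\<Sum>k\<in>I (d i). W $$ (k, i) * W $$ (k, j))"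
      by (rule sum.mono_neutral_right) (use W ij in \<open>auto simp: I_def\<close>)
    with True show ?thesis
      by simp
  next
    case False
    have "W $$ (k, i) * W $$ (k, j) = 0" if "k < n" for k
      using W ij False that by (cases "d k = d i") auto
    then have "(\<Sum>k<n. W $$ (k, i) * W $$ (k, j)) = 0"
      by (intro sum.neutral) simp
    with False show ?thesis
      by simp
  qed
  \<comment> \<open>Cut \<open>W\<close> into its diagonal blocks; the inverse map glues blocks
    together and fills in zeros elsewhere. A value in \<open>P\<close> that \<open>d\<close> does
    not attain has an empty block and contributes the single element of the orthogonal group of size
    0.\<close>
  have "bij_betw (\<lambda>W :: 'a mat. \<lambda>a\<in>P. restrict (\<lambda>ij. W $$ ij) (I a \<times> I a)) S
    (\<Pi>\<^sub>E a\<in>P. orthogonal_on (I a))"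
  proof (rule bij_betw_byWitness[where
        f' = "\<lambda>G. mat n n (\<lambda>(i, j). if d i = d j then G (d i) (i, j) else 0)"])
    show "\<forall>W\<in>S. mat n n (\<lambda>(i, j). if d i = d j
      then (\<lambda>a\<in>P. restrict (\<lambda>ij. W $$ ij) (I a \<times> I a)) (d i) (i, j) else 0) = W"
    proof
      fix W assume W: "W \<in> S"
      then have "W \<in> carrier_mat n n"
        by (auto simp: S_def orthogonal_matricesD(1))
      then show "mat n n (\<lambda>(i, j). if d i = d j
        then (\<lambda>a\<in>P. restrict (\<lambda>ij. W $$ ij) (I a \<times> I a)) (d i) (i, j) else 0) = W"
        using W by (auto intro!: eq_matI simp: S_def I_def dP)
    qed
    show "\<forall>G\<in>\<Pi>\<^sub>E a\<in>P. orthogonal_on (I a). (\<lambda>a\<in>P. restrict (\<lambda>ij. mat n n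
      (\<lambda>(i, j). if d i = d j then G (d i) (i, j) else 0) $$ ij) (I a \<times> I a)) = (G :: 'a \<Rightarrow> nat \<times> nat \<Rightarrow> 'a)"
    proof
      fix G :: "'a \<Rightarrow> nat \<times> nat \<Rightarrow> 'a" assume G: "G \<in> (\<Pi>\<^sub>E a\<in>P. orthogonal_on (I a))"
      \<comment> \<open>Gluing and cutting again recovers \<open>G a\<close> on its block; off the
        block both functions are \<open>undefined\<close>.\<close>
      then have G_ext: "G a \<in> extensional (I a \<times> I a)" if "a \<in> P" for a
        using that by (auto simp: orthogonal_on_def PiE_def Pi_def)
      show "(\<lambda>a\<in>P. restrict (\<lambda>ij. mat n n
        (\<lambda>(i, j). if d i = d j then G (d i) (i, j) else 0) $$ ij) (I a \<times> I a)) = G"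
      proof (rule ext, goal_cases)
        case (1 a)
        show ?case
        proof (cases "a \<in> P")
          case True
          show ?thesis
            using G_ext[OF True] True
            by (auto simp: fun_eq_iff restrict_def extensional_def I_def)
        next
          case False
          with G show ?thesis
            by (auto simp: PiE_def extensional_def)
        qed
      qed
    qed
    show "(\<lambda>W :: 'a mat. \<lambda>a\<in>P. restrict (\<lambda>ij. W $$ ij) (I a \<times> I a)) ` S \<subseteq>
      (\<Pi>\<^sub>E a\<in>P. orthogonal_on (I a))"
    proof (intro image_subsetI restrict_PiE_iff[THEN iffD2] ballI)
      fix W a assume W: "W \<in> S" and "a \<in> P"
      have orth: "(\<Sum>k<n. W $$ (k, i) * W $$ (k, j)) = (if i = j then 1 else 0)"
        if "i < n" "j < n" for i j
      proof -
        have "W \<in> orthogonal_matrices n"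
          using W by (simp add: S_def)
        then show ?thesis
          using orthogonal_matrices_index[OF orthogonal_matricesD(1)] that by blast
      qed
      have "(\<Sum>k\<in>I a. W $$ (k, i) * W $$ (k, j)) = (if i = j then 1 else 0)"
        if "i \<in> I a" "j \<in> I a" for i j
        using gram[of W i j] orth[of i j] W that by (auto simp: S_def I_def)
      then show "restrict (\<lambda>ij. W $$ ij) (I a \<times> I a) \<in> orthogonal_on (I a)"
        by (simp add: orthogonal_on_def)
    qed
    show "(\<lambda>G. mat n n (\<lambda>(i, j). if d i = d j then G (d i) (i, j) else 0)) `
      (\<Pi>\<^sub>E a\<in>P. orthogonal_on (I a)) \<subseteq> S"
    proof (rule image_subsetI)
      fix G :: "'a \<Rightarrow> nat \<times> nat \<Rightarrow> 'a" assume G: "G \<in> (\<Pi>\<^sub>E a\<in>P. orthogonal_on (I a))"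
      define W where "W = mat n n (\<lambda>(i, j). if d i = d j then G (d i) (i, j) else 0)"
      have W: "W \<in> carrier_mat n n" and W0: "\<forall>i<n. \<forall>j<n. d i \<noteq> d j \<longrightarrow> W $$ (i, j) = 0"
        by (auto simp: W_def)
      have "(\<Sum>k<n. W $$ (k, i) * W $$ (k, j)) = (if i = j then 1 else 0)"
        if ij: "i < n" "j < n" for i j
      proof (cases "d i = d j")
        case True
        have "(\<Sum>k<n. W $$ (k, i) * W $$ (k, j)) = (\<Sum>k\<in>I (d i). W $$ (k, i) * W $$ (k, j))"
          using gram[OF W0 ij] True by simp
        also have "\<dots> = (\<Sum>k\<in>I (d i). G (d i) (k, i) * G (d i) (k, j))"
          by (rule sum.cong) (use ij True in \<open>auto simp: W_def I_def\<close>)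
        also have "\<dots> = (if i = j then 1 else 0)"
        proof -
          have "G (d i) \<in> orthogonal_on (I (d i))"
            using G dP[OF ij(1)] by auto
          then show ?thesis
            using ij True by (simp add: orthogonal_on_def I_def)
        qed
        finally show ?thesis .
      next
        \<comment> \<open>Different diagonal values force \<open>i \<noteq> j\<close>, so the
          required value is 0.\<close>
        case False
        then show ?thesis
          using gram[OF W0 ij] by auto
      qed
      then have "W \<in> orthogonal_matrices n"
        using orthogonal_matrices_index[OF W] by blast
      with W0 show "mat n n (\<lambda>(i, j). if d i = d j then G (d i) (i, j) else 0) \<in> S"
        by (simp add: S_def W_def)
    qed
  qed
  then have "card S = card (\<Pi>\<^sub>E a\<in>P. orthogonal_on (I a) :: (nat \<times> nat \<Rightarrow> 'a) set)"
    by (rule bij_betw_same_card)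
  also have "\<dots> = (\<Prod>a\<in>P. card (orthogonal_matrices (card (I a)) :: 'a mat set))"
    using P by (simp add: card_PiE card_orthogonal_on I_def)
  finally show ?thesis
    by (simp add: S I_def)
qed

section \<open>Classification of the orbits of diagonal matrices\<close>

lemma transpose_mat_diag [simp]: "transpose_mat (mat_diag n d) = mat_diag n d"
  by (auto simp: mat_diag_def)

text \<open>The characteristic polynomial of a triangular matrix is the product of the linear
  factors given by its diagonal. Its roots with multiplicity are the invariant that separates the
  orbits.\<close>

lemma proots_char_poly_mat_diag:
  fixes xs :: "'a::field list"
  assumes "length xs = n"
  shows "proots (char_poly (mat_diag n ((!) xs))) = mset xs"
proof -
  have "diag_mat (mat_diag n ((!) xs)) = xs"
    using assms by (auto simp: diag_mat_def mat_diag_def intro!: nth_equalityI)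
  moreover have "upper_triangular (mat_diag n ((!) xs))"
    by (auto simp: mat_diag_def)
  ultimately have "char_poly (mat_diag n ((!) xs)) = (\<Prod>a\<leftarrow>xs. [:- a, 1:])"
    using char_poly_upper_triangular[OF mat_diag_dim] by metis
  moreover have "proots (\<Prod>a\<leftarrow>ys. [:- a, 1:]) = mset ys" for ys :: "'a list"
  proof (induction ys)
    case (Cons y ys)
    \<comment> \<open>Root multisets add up under multiplication of nonzero polynomials.\<close>
    have "(\<Prod>a\<leftarrow>ys. [:- a, 1:]) \<noteq> 0"
      by (auto simp: prod_list_zero_iff)
    with Cons show ?case
      by (simp add: proots_mult del: mult_pCons_left)
  qed simp
  ultimately show ?thesis
    by simp
qed

text \<open>Conjugation by an orthogonal matrix is a similarity.\<close>

lemma orthogonal_orbit_char_poly: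
  fixes D :: "'a::field mat"
  assumes "D \<in> carrier_mat n n" "A \<in> orthogonal_orbit n D"
  shows "char_poly A = char_poly D"
proof -
  obtain U where U: "U \<in> orthogonal_matrices n" and A: "A = transpose_mat U * D * U"
    using assms(2) by (auto simp: orthogonal_orbit_def)
  have "similar_mat_wit A D (transpose_mat U) U"
    using orthogonal_matricesD[OF U] assms(1) by (auto simp: similar_mat_wit_def A Let_def)
  then show ?thesis
    by (intro char_poly_similar) (auto simp: similar_mat_def)
qed

lemma orthogonal_orbit_trans:
  fixes D :: "'a::field mat"
  assumes "D \<in> carrier_mat n n" "E \<in> orthogonal_orbit n D" "A \<in> orthogonal_orbit n E"
  shows "A \<in> orthogonal_orbit n D"
proof -
  obtain W where W: "W \<in> orthogonal_matrices n" and E: "E = transpose_mat W * D * W"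
    using assms(2) by (auto simp: orthogonal_orbit_def)
  obtain U where U: "U \<in> orthogonal_matrices n" and A: "A = transpose_mat U * E * U"
    using assms(3) by (auto simp: orthogonal_orbit_def)
  have "A = transpose_mat (W * U) * D * (W * U)"
    using orthogonal_conjugate_mult[OF orthogonal_matricesD(1)[OF U] orthogonal_matricesD(1)[OF W]
        assms(1)] A E by simp
  then show ?thesis
    using mult_orthogonal_matrices[OF W U] by (auto simp: orthogonal_orbit_def)
qed

text \<open>Lists with the same multiset differ by a permutation, whose permutation matrix is
  orthogonal and rearranges the diagonal accordingly.\<close>

lemma mat_diag_in_orthogonal_orbit:
  fixes xs ys :: "'a::field list"
  assumes "mset xs = mset ys" "length ys = n"
  shows "mat_diag n ((!) xs) \<in> orthogonal_orbit n (mat_diag n ((!) ys))"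
proof -
  obtain p where p: "p permutes {..<length ys}" and xs: "permute_list p ys = xs"
    using mset_eq_permutation[OF assms(1)] by blast
  have nth: "xs ! i = ys ! p i" if "i < n" for i
    using permute_list_nth[OF p] that assms(2) xs by auto
  have pn: "p i < n" if "i < n" for i
    using permutes_in_image[OF p] that assms(2) by auto
  have inj: "p i = p j \<longleftrightarrow> i = j" for i j
    using permutes_inj[OF p] by (auto dest: injD)
  \<comment> \<open>Column \<open>i\<close> of \<open>Q\<close> is the unit vector at position
    \<open>p i\<close>, so conjugating by \<open>Q\<close> moves the entry \<open>ys ! p i\<close>,
    which is \<open>xs ! i\<close>, to position \<open>i\<close>.\<close>
  define Q :: "'a mat" where "Q = mat n n (\<lambda>(k, i). if k = p i then 1 else 0)"
  have Q: "Q \<in> carrier_mat n n"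
    by (simp add: Q_def)
  \<comment> \<open>Only \<open>k = p i\<close> contributes. Weights 1 give the orthogonality of
    \<open>Q\<close>; the weights \<open>ys ! k\<close> give the entries of the conjugated diagonal
    matrix.\<close>
  have weighted: "(\<Sum>k<n. Q $$ (k, i) * (c k * Q $$ (k, j))) = (if i = j then c (p i) else 0)"
    if "i < n" "j < n" for i j and c :: "nat \<Rightarrow> 'a"
  proof -
    have "(\<Sum>k<n. Q $$ (k, i) * (c k * Q $$ (k, j))) =
        (\<Sum>k<n. if k = p i then (if i = j then c (p i) else 0) else 0)"
      by (rule sum.cong) (use that in \<open>auto simp: Q_def inj\<close>)
    then show ?thesis
      using pn that by simp
  qed
  have "Q \<in> orthogonal_matrices n"
    using weighted[of _ _ "\<lambda>_. 1"] orthogonal_matrices_index[OF Q] by simp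
  moreover have "mat_diag n ((!) xs) = transpose_mat Q * mat_diag n ((!) ys) * Q"
  proof (rule eq_matI)
    fix i j
    assume "i < dim_row (transpose_mat Q * mat_diag n ((!) ys) * Q)"
      and "j < dim_col (transpose_mat Q * mat_diag n ((!) ys) * Q)"
    then have ij: "i < n" "j < n"
      by (auto simp: Q_def)
    have "(transpose_mat Q * mat_diag n ((!) ys) * Q) $$ (i, j) =
        (transpose_mat Q * (mat_diag n ((!) ys) * Q)) $$ (i, j)"
      using Q by (simp add: assoc_mult_mat[of _ n n _ n _ n])
    also have "\<dots> = (\<Sum>k<n. Q $$ (k, i) * (ys ! k * Q $$ (k, j)))"
      using Q ij by (simp add: mat_diag_mult_left scalar_prod_def atLeast0LessThan)
    also have "\<dots> = mat_diag n ((!) xs) $$ (i, j)"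
      using weighted[OF ij, of "(!) ys"] ij nth by (auto simp: mat_diag_def)
    finally show "mat_diag n ((!) xs) $$ (i, j) =
        (transpose_mat Q * mat_diag n ((!) ys) * Q) $$ (i, j)" by simp
  qed (use Q in \<open>auto simp: mat_diag_def\<close>)
  ultimately show ?thesis
    unfolding orthogonal_orbit_def by (rule rev_image_eqI)
qed

section \<open>Positive definite matrices of type 4 as members of orbits\<close>

text \<open>The diagonal is recorded as a list, so that multisets and permutations apply to it. For
  the converse, a conjugate of \<open>D\<close> inherits symmetry from \<open>D\<close>, and
  conjugating the inverse of \<open>D\<close> gives its inverse.\<close>

lemma positive_definite_type4_iff:
  fixes A :: "'a::field mat"
  shows "positive_definite_type4 n A \<longleftrightarrow>
    (\<exists>xs. length xs = n \<and> set xs \<subseteq> positive_elements \<and> A \<in> orthogonal_orbit n (mat_diag n ((!) xs)))"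
proof
  assume "positive_definite_type4 n A"
  then obtain U V D where U: "U \<in> orthogonal_matrices n" and V: "V \<in> carrier_mat n n"
    and UV: "inverts_mat U V" and D: "D \<in> general_linear n" "diagonal_mat D"
    and pos: "\<And>i. i < n \<Longrightarrow> D $$ (i, i) \<in> positive_elements" and A: "A = V * D * U"
    by (auto simp: positive_definite_type4_def)
  note Uc = orthogonal_matricesD[OF U]
  \<comment> \<open>Uniqueness of inverses: \<open>V\<close> and \<open>transpose_mat U\<close> both
    invert \<open>U\<close>.\<close>
  have "V = (transpose_mat U * U) * V"
    using Uc V by simp
  also have "\<dots> = transpose_mat U * (U * V)"
    using Uc(1,2) V by (simp add: assoc_mult_mat[of _ n n _ n _ n])
  also have "\<dots> = transpose_mat U"
    using UV Uc by (simp add: inverts_mat_def)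
  finally have V': "V = transpose_mat U" .
  define xs where "xs = map (\<lambda>i. D $$ (i, i)) [0..<n]"
  have "D = mat_diag n ((!) xs)"
    using D by (auto intro!: eq_matI
        simp: xs_def mat_diag_def general_linear_def diagonal_mat_def)
  then have "A \<in> orthogonal_orbit n (mat_diag n ((!) xs))"
    using A U V' by (auto simp: orthogonal_orbit_def)
  moreover have "length xs = n" "set xs \<subseteq> positive_elements"
    using pos by (auto simp: xs_def)
  ultimately show "\<exists>xs. length xs = n \<and> set xs \<subseteq> positive_elements \<and>
      A \<in> orthogonal_orbit n (mat_diag n ((!) xs))"
    by blast
next
  assume "\<exists>xs. length xs = n \<and> set xs \<subseteq> positive_elements \<and>
      A \<in> orthogonal_orbit n (mat_diag n ((!) xs))"
  then obtain xs U where len: "length xs = n" and xs: "set xs \<subseteq> positive_elements"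
    and U: "U \<in> orthogonal_matrices n" and A: "A = transpose_mat U * mat_diag n ((!) xs) * U"
    by (auto simp: orthogonal_orbit_def)
  note Uc = orthogonal_matricesD[OF U]
  define D where "D = mat_diag n ((!) xs)"
  have A': "A = transpose_mat U * D * U"
    by (simp add: A D_def)
  \<comment> \<open>The inverse of \<open>D\<close>; it exists because positive elements are
    nonzero.\<close>
  define E where "E = mat_diag n (\<lambda>i. inverse (xs ! i))"
  have Dc: "D \<in> carrier_mat n n" and Ec: "E \<in> carrier_mat n n"
    by (auto simp: D_def E_def)
  have pos: "xs ! i \<in> positive_elements" if "i < n" for i
    using xs len that by auto
  then have nz: "xs ! i \<noteq> 0" if "i < n" for i
    using that by (auto simp: positive_elements_def)
  have DE: "D * E = 1\<^sub>m n" "E * D = 1\<^sub>m n"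
    unfolding D_def E_def mat_diag_diag by (auto simp: mat_diag_def nz intro!: eq_matI)
  \<comment> \<open>Applied to \<open>D\<close>, \<open>E\<close> in both orders, this makes the
    conjugate of \<open>E\<close> a two-sided inverse of \<open>A\<close>.\<close>
  have cancel: "(transpose_mat U * X * U) * (transpose_mat U * Y * U) = 1\<^sub>m n"
    if "X \<in> carrier_mat n n" "Y \<in> carrier_mat n n" "X * Y = 1\<^sub>m n" for X Y
  proof -
    have "(transpose_mat U * X * U) * (transpose_mat U * Y * U) =
        transpose_mat U * (X * ((U * transpose_mat U) * (Y * U)))"
      using Uc(1,2) that(1,2) by (simp add: assoc_mult_mat[of _ n n _ n _ n])
    also have "\<dots> = transpose_mat U * ((X * Y) * U)"
      using Uc that(1,2) by (simp add: assoc_mult_mat[of _ n n _ n _ n])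
    finally show ?thesis
      using Uc that by simp
  qed
  have Ac: "A \<in> carrier_mat n n"
    using A' Uc(1,2) Dc by simp
  have "D \<in> general_linear n"
    using Dc Ec DE by (auto simp: general_linear_def invertible_mat_def inverts_mat_def
        square_mat.simps)
  moreover have "A \<in> general_linear n"
    using Ac cancel[OF Dc Ec DE(1)] cancel[OF Ec Dc DE(2)] Uc Ec
    by (auto simp: general_linear_def invertible_mat_def inverts_mat_def square_mat.simps A'
        intro!: exI[of _ "transpose_mat U * E * U"])
  moreover have "transpose_mat A = A"
  proof -
    have "transpose_mat D = D"
      by (simp add: D_def)
    then show ?thesis
      using Uc(1,2) Dc unfolding A'
      by (simp add: transpose_mult[of _ n n _ n] assoc_mult_mat[of _ n n _ n _ n])
  qed
  moreover have "diagonal_mat D" "\<forall>i<n. D $$ (i, i) \<in> positive_elements"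
    using pos by (auto simp: D_def mat_diag_def diagonal_mat_def)
  moreover have "inverts_mat U (transpose_mat U)" "inverts_mat (transpose_mat U) U"
    using Uc by (auto simp: inverts_mat_def)
  ultimately show "positive_definite_type4 n A"
    unfolding positive_definite_type4_def using U Uc(2) A' by blast
qed

section \<open>Multisets as lists of multiplicities\<close>

text \<open>Canonical representatives: when \<open>ps\<close> enumerates the positive elements
  without repetition, each tuple \<open>ks\<close> of the right length and sum selects one diagonal
  from one orbit.\<close>

definition list_of_multiplicities :: "'b list \<Rightarrow> nat list \<Rightarrow> 'b list" where
  "list_of_multiplicities ps ks = concat (map2 (\<lambda>p k. replicate k p) ps ks)"

lemma length_list_of_multiplicities:
  "length ks = length ps \<Longrightarrow> length (list_of_multiplicities ps ks) = sum_list ks"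
  by (induction ks ps rule: list_induct2) (auto simp: list_of_multiplicities_def)

lemma set_list_of_multiplicities: "set (list_of_multiplicities ps ks) \<subseteq> set ps"
  by (auto simp: list_of_multiplicities_def dest: set_zip_leftD)

lemma count_list_of_multiplicities:
  assumes "length ks = length ps" "distinct ps" "i < length ps"
  shows "count_list (list_of_multiplicities ps ks) (ps ! i) = ks ! i"
  using assms
proof (induction ks ps arbitrary: i rule: list_induct2)
  case (Cons k ks p ps)
  have rep: "count_list (replicate k p) a = (if a = p then k else 0)" for a
    by (induction k) auto
  \<comment> \<open>By distinctness \<open>p\<close> occurs in its own block only.\<close>
  have "p \<notin> set (list_of_multiplicities ps ks)"
    using set_list_of_multiplicities[of ps ks] Cons.prems by auto
  then have "count_list (list_of_multiplicities ps ks) p = 0"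
    by simp
  moreover have "list_of_multiplicities (p # ps) (k # ks) =
      replicate k p @ list_of_multiplicities ps ks"
    by (simp add: list_of_multiplicities_def)
  ultimately show ?case
    using Cons by (cases i) (auto simp: rep)
qed simp

text \<open>Recording the counts of a list and rebuilding from them only reorders it; hence every
  diagonal with entries in \<open>ps\<close> is covered by some tuple.\<close>

lemma mset_list_of_multiplicities:
  assumes "set xs \<subseteq> set ps" "distinct ps"
  shows "mset (list_of_multiplicities ps (map (count_list xs) ps)) = mset xs"
proof (rule multiset_eqI)
  fix a
  let ?ks = "map (count_list xs) ps"
  show "count (mset (list_of_multiplicities ps ?ks)) a = count (mset xs) a"
  proof (cases "a \<in> set ps")
    case True
    then obtain i where "i < length ps" "a = ps ! i"
      by (auto simp: in_set_conv_nth)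
    then show ?thesis
      using count_list_of_multiplicities[of ?ks ps i] assms(2) by (simp add: count_mset)
  next
    case False
    then have "a \<notin> set xs" "a \<notin> set (list_of_multiplicities ps ?ks)"
      using assms(1) set_list_of_multiplicities[of ps ?ks] by auto
    then show ?thesis
      by (simp add: count_mset)
  qed
qed

lemma finite_lists_sum_list: "finite {ks :: nat list. length ks = s \<and> sum_list ks = n}"
  by (rule finite_subset[OF _ finite_lists_length_eq[of "{..n}" s]])
    (auto intro: member_le_sum_list)

section \<open>Summation over the orbits\<close>

theorem theorem3p20:
  fixes q n s :: nat
  assumes "primepow q"
    and "card (UNIV :: 'a::{field,finite} set) = q"
    and "n \<ge> 1"
    and "s = card (positive_elements :: 'a set)"
  shows "of_nat (card {A :: 'a mat. positive_definite_type4 n A}) =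
    (\<Sum>ks \<in> {ks :: nat list. length ks = s \<and> sum_list ks = n}.
       (of_nat (card (orthogonal_matrices n :: 'a mat set)) :: rat) /
       (\<Prod>i<s. of_nat (card (orthogonal_matrices (ks ! i) :: 'a mat set))))"
proof -
  \<comment> \<open>A fixed enumeration of the positive elements turns the position \<open>i\<close>
    in a tuple into the element \<open>ps ! i\<close>.\<close>
  obtain ps where ps: "set ps = (positive_elements :: 'a set)" "distinct ps"
    using finite_distinct_list[of "positive_elements :: 'a set"] by auto
  have len_ps: "length ps = s"
    using ps assms(4) distinct_card by metis
  define K where "K = {ks :: nat list. length ks = s \<and> sum_list ks = n}"
  define xs where "xs = list_of_multiplicities ps"
  define orb where "orb ks = orthogonal_orbit n (mat_diag n ((!) (xs ks)))" for ks
  have len: "length (xs ks) = n" if "ks \<in> K" for ks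
    using that len_ps by (simp add: K_def xs_def length_list_of_multiplicities)
  have cnt: "count_list (xs ks) (ps ! i) = ks ! i" if "ks \<in> K" "i < s" for ks i
    using that len_ps ps(2) by (simp add: K_def xs_def count_list_of_multiplicities)
  have union: "{A :: 'a mat. positive_definite_type4 n A} = (\<Union>ks\<in>K. orb ks)"
  proof (intro equalityI subsetI)
    fix A :: "'a mat" assume "A \<in> {A. positive_definite_type4 n A}"
    then obtain ys where ys: "length ys = n" "set ys \<subseteq> set ps"
      and A: "A \<in> orthogonal_orbit n (mat_diag n ((!) ys))"
      unfolding ps(1) by (auto simp: positive_definite_type4_iff)
    \<comment> \<open>The tuple of multiplicities of \<open>ys\<close>. Its canonical list is a
      reordering of \<open>ys\<close>, so both diagonal matrices lie in one orbit.\<close>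
    define ks where "ks = map (count_list ys) ps"
    have mset_eq: "mset (xs ks) = mset ys"
      unfolding xs_def ks_def by (rule mset_list_of_multiplicities[OF ys(2) ps(2)])
    have "length (xs ks) = sum_list ks"
      unfolding xs_def by (rule length_list_of_multiplicities) (simp add: ks_def)
    with mset_eq ys(1) have n: "length (xs ks) = n" "sum_list ks = n"
      using mset_eq_length by metis+
    then have "ks \<in> K"
      using len_ps by (simp add: K_def ks_def)
    moreover have "A \<in> orb ks"
      unfolding orb_def
      using orthogonal_orbit_trans[OF mat_diag_dim
          mat_diag_in_orthogonal_orbit[OF mset_eq[symmetric] n(1)] A] .
    ultimately show "A \<in> (\<Union>ks\<in>K. orb ks)"
      by blast
  next
    fix A :: "'a mat" assume "A \<in> (\<Union>ks\<in>K. orb ks)"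
    then show "A \<in> {A. positive_definite_type4 n A}"
      using len set_list_of_multiplicities[of ps] ps(1)
      unfolding mem_Collect_eq positive_definite_type4_iff orb_def xs_def by blast
  qed
  \<comment> \<open>A common member makes the characteristic polynomials agree, hence the multisets
    of diagonal entries, hence the multiplicities \<open>ks\<close> and \<open>ls\<close>.\<close>
  have disj: "orb ks \<inter> orb ls = {}" if "ks \<in> K" "ls \<in> K" "ks \<noteq> ls" for ks ls
  proof (rule ccontr)
    assume "orb ks \<inter> orb ls \<noteq> {}"
    then obtain A where "A \<in> orb ks" "A \<in> orb ls"
      by blast
    then have "mset (xs ks) = mset (xs ls)"
      using orthogonal_orbit_char_poly[OF mat_diag_dim] proots_char_poly_mat_diag len that(1,2)
      unfolding orb_def by metis
    then have "count_list (xs ks) = count_list (xs ls)"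
      by (metis count_mset ext)
    then have "ks = ls"
      using cnt that by (intro nth_equalityI) (auto simp: K_def, metis)
    with that(3) show False ..
  qed
  have card_orb: "(of_nat (card (orb ks)) :: rat) =
      of_nat (card (orthogonal_matrices n :: 'a mat set)) /
      (\<Prod>i<s. of_nat (card (orthogonal_matrices (ks ! i) :: 'a mat set)))" if "ks \<in> K" for ks
  proof -
    \<comment> \<open>Taking all positive elements as the value set gives one factor per position of
      the tuple, including the positions with multiplicity 0.\<close>
    have "card (orthogonal_stabilizer n (mat_diag n ((!) (xs ks)))) =
        (\<Prod>a\<in>set ps. card (orthogonal_matrices (card {i. i < n \<and> xs ks ! i = a}) :: 'a mat set))"
    proof (rule card_orthogonal_stabilizer_mat_diag)
      show "xs ks ! i \<in> set ps" if "i < n" for i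
        using that len[OF \<open>ks \<in> K\<close>] set_list_of_multiplicities[of ps ks] by (auto simp: xs_def)
    qed simp
    \<comment> \<open>Pass from elements to their positions in \<open>ps\<close>; the size of a
      level set is the count of its value in the list.\<close>
    also have "\<dots> = (\<Prod>i<s. card (orthogonal_matrices (count_list (xs ks) (ps ! i)) :: 'a mat set))"
      using len[OF that]
      by (intro prod.reindex_bij_betw[OF bij_betw_nth[OF ps(2)], symmetric, THEN trans])
        (auto simp: len_ps count_list_eq_length_filter length_filter_conv_card eq_commute)
    also have "\<dots> = (\<Prod>i<s. card (orthogonal_matrices (ks ! i) :: 'a mat set))"
      using cnt[OF that] by simp
    finally have "card (orb ks) * (\<Prod>i<s. card (orthogonal_matrices (ks ! i) :: 'a mat set)) =
        card (orthogonal_matrices n :: 'a mat set)"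
      using card_orthogonal_orbit_stabilizer[of "mat_diag n ((!) (xs ks))" n]
      by (simp add: orb_def)
    \<comment> \<open>The product formula holds in the naturals. It becomes a quotient of rationals
      since every orthogonal group contains the identity and so has positive size.\<close>
    then have "(of_nat (card (orb ks)) :: rat) *
        (\<Prod>i<s. of_nat (card (orthogonal_matrices (ks ! i) :: 'a mat set))) =
        of_nat (card (orthogonal_matrices n :: 'a mat set))"
      by (metis of_nat_mult of_nat_prod)
    moreover have "(\<Prod>i<s. of_nat (card (orthogonal_matrices (ks ! i) :: 'a mat set))) \<noteq> (0 :: rat)"
      using card_orthogonal_matrices_pos[where 'a = 'a] by (simp add: less_imp_neq[symmetric])
    ultimately show ?thesis
      by (simp add: eq_divide_eq)
  qed
  have "card {A :: 'a mat. positive_definite_type4 n A} = (\<Sum>ks\<in>K. card (orb ks))"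
    unfolding union
    by (rule card_UN_disjoint)
      (use disj finite_lists_sum_list finite_orthogonal_matrices[where 'a = 'a] in
        \<open>auto simp: K_def orb_def orthogonal_orbit_def\<close>)
  then show ?thesis
    using card_orb by (simp add: K_def)
qed

end
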